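(* Let $D=\{1,\dots,d\}$, let $X=(X_1,\dots,X_d)$ be a random vector in $\mathbb{R}^d$ and let $F:\mathbb{R}^d\to\mathbb{R}$ be measurable, all expectations involved being assumed to exist. (i) If $F$ is linear, $F(x)=\sum_{i\in D}\beta_i x_i$, then marginal fANOVA equals baseline fANOVA with $b:=\mathbb{E}[X]$, i.e. $f^{(m)}_S=f^{(b)}_S$ for all $S\subseteq D$. (ii) If the features $X_1,\dots,X_d$ are independent, then conditional fANOVA equals marginal fANOVA, i.e. $f^{(c)}_S=f^{(m)}_S$ for all $S\subseteq D$. (iii) If the features $X_1,\dots,X_d$ are independent and $F$ is multilinear, i.e. $F(x)=\sum_{L\subseteq D}c_L\prod_{i\in L}x_i$ with constants $c_L\in\mathbb{R}$, then conditional and marginal fANOVA both also equal baseline fANOVA with $b:=\mathbb{E}[X]$, i.e. $f^{(c)}_S=f^{(m)}_S=f^{(b)}_S$ for all $S\subseteq D$.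
   Context: Notation: $-S:=D\setminus S$; $(x_S,y_{-S})$ is the point with coordinates $x_i$ for $i\in S$ and $y_i$ for $i\notin S$. For $S\subseteq D$ define the value functions - baseline (with baseline $b\in\mathbb{R}^d$): $F^{(b)}_S(x):=F(x_S,b_{-S})$; - marginal: $F^{(m)}_S(x):=\mathbb{E}[F(x_S,X_{-S})]$ (expectation over the joint marginal distribution of $X_{-S}$); - conditional: $F^{(c)}_S(x):=\mathbb{E}[F(X)\mid X_S=x_S]$. For each type $\ast\in\{b,m,c\}$ the fANOVA effects are defined recursively by $f^{(\ast)}_S(x):=F^{(\ast)}_S(x)-\sum_{T\subsetneq S}f^{(\ast)}_T(x)$, $S\subseteq D$. Conditional expectations are determined up to null sets of the law of $X$, so identities involving $f^{(c)}_S$ are understood to hold for almost every $x$ with respect to the law of $X$. *)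

theory Defs
  imports "HOL-Probability.Probability"
begin

text \<open>
  The index set \<open>D\<close> is the finite type \<open>'n\<close>, so \<open>- S\<close> is complement in \<open>D\<close>.
  \<open>glue S x y\<close> is the point \<open>(x\<^sub>S, y\<^sub>-\<^sub>S)\<close>.
\<close>

definition glue :: "'n set \<Rightarrow> real ^ 'n \<Rightarrow> real ^ 'n \<Rightarrow> real ^ 'n" where
  "glue S x y = (\<chi> i. if i \<in> S then x $ i else y $ i)"

definition baseline_value ::
  "real ^ 'n \<Rightarrow> (real ^ 'n \<Rightarrow> real) \<Rightarrow> 'n set \<Rightarrow> real ^ 'n \<Rightarrow> real" where
  "baseline_value b F S x = F (glue S x b)"

definition marginal_value ::
  "'a measure \<Rightarrow> ('a \<Rightarrow> real ^ 'n) \<Rightarrow> (real ^ 'n \<Rightarrow> real) \<Rightarrow> 'n set \<Rightarrow> real ^ 'n \<Rightarrow> real" where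
  "marginal_value M X F S x = (LINT \<omega>|M. F (glue S x (X \<omega>)))"

definition subvector :: "'n set \<Rightarrow> real ^ 'n \<Rightarrow> 'n \<Rightarrow> real" where
  "subvector S x = restrict (($) x) S"

definition coord_algebra :: "'n set \<Rightarrow> (real ^ 'n) measure" where
  "coord_algebra S = vimage_algebra UNIV (subvector S) (Pi\<^sub>M S (\<lambda>_. borel))"

text \<open>
  As a function of \<open>x\<close>, \<open>E[F(X) | X\<^sub>S = x\<^sub>S]\<close> is the conditional expectation of \<open>F\<close> given the
  coordinates in \<open>S\<close>, taken under the law of \<open>X\<close>. It is one version, determined up to null sets of
  the law of \<open>X\<close>; lemma \<open>conditional_value_comp\<close> below relates it to conditioning on \<open>X\<^sub>S\<close> in the
  original probability space.
\<close>

definition conditional_value ::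
  "'a measure \<Rightarrow> ('a \<Rightarrow> real ^ 'n) \<Rightarrow> (real ^ 'n \<Rightarrow> real) \<Rightarrow> 'n set \<Rightarrow> real ^ 'n \<Rightarrow> real" where
  "conditional_value M X F S = real_cond_exp (distr M borel X) (coord_algebra S) F"

function fanova :: "(('n::finite) set \<Rightarrow> 'b \<Rightarrow> real) \<Rightarrow> 'n set \<Rightarrow> 'b \<Rightarrow> real" where
  "fanova V S x = V S x - (\<Sum>T | T \<subset> S. fanova V T x)"
  by pat_completeness auto
termination
  by (relation "Wellfounded.measure (\<lambda>(V, S, x). card S)") (auto intro: psubset_card_mono)

declare fanova.simps [simp del]

lemma measurable_subvector [measurable]:
  "subvector S \<in> borel \<rightarrow>\<^sub>M Pi\<^sub>M S (\<lambda>_. borel)"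
  unfolding subvector_def by measurable

lemma subalgebra_coord_algebra:
  "subalgebra (distr M borel X) (coord_algebra S)"
  unfolding subalgebra_def coord_algebra_def
  using measurable_sets[OF measurable_subvector, of _ S]
  by (auto simp: sets_vimage_algebra2 space_PiM subvector_def PiE_def)

lemma conditional_value_comp:
  fixes X :: "'a \<Rightarrow> real ^ 'n"
  assumes "prob_space M" and X[measurable]: "X \<in> borel_measurable M"
    and F[measurable]: "F \<in> borel_measurable borel"
    and int: "integrable M (\<lambda>\<omega>. F (X \<omega>))"
  shows "AE \<omega> in M. conditional_value M X F S (X \<omega>) =
    real_cond_exp M (vimage_algebra (space M) (\<lambda>\<omega>. subvector S (X \<omega>)) (Pi\<^sub>M S (\<lambda>_. borel)))
      (\<lambda>\<omega>. F (X \<omega>)) \<omega>"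
proof -
  interpret prob_space M by fact
  interpret D: prob_space "distr M borel X" by (rule prob_space_distr) simp
  let ?P = "Pi\<^sub>M S (\<lambda>_. borel :: real measure)"
  let ?G = "vimage_algebra (space M) (\<lambda>\<omega>. subvector S (X \<omega>)) ?P"
  let ?N = "distr M borel X"
  have m: "(\<lambda>\<omega>. subvector S (X \<omega>)) \<in> M \<rightarrow>\<^sub>M ?P" by measurable
  have mN: "coord_algebra S \<rightarrow>\<^sub>M (borel::real measure) \<subseteq> borel_measurable borel"
    using measurable_from_subalg[OF subalgebra_coord_algebra[of M X S]] by auto
  have sub: "subalgebra M ?G"
    unfolding subalgebra_def using measurable_sets[OF m] measurable_space[OF m]
    by (auto simp: sets_vimage_algebra2)
  interpret G: sigma_finite_subalgebra M ?G
    by (rule finite_measure_subalgebra_is_sigma_finite)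
      (simp add: finite_measure_subalgebra_def finite_measure_subalgebra_axioms_def sub finite_measure_axioms)
  interpret C: sigma_finite_subalgebra ?N "coord_algebra S"
    by (rule finite_measure_subalgebra_is_sigma_finite)
      (simp add: finite_measure_subalgebra_def finite_measure_subalgebra_axioms_def
        subalgebra_coord_algebra D.finite_measure_axioms)
  let ?g = "conditional_value M X F S"
  have intN: "integrable ?N F" using int by (simp add: integrable_distr_eq)
  have gC: "?g \<in> borel_measurable (coord_algebra S)"
    unfolding conditional_value_def by (rule borel_measurable_cond_exp)
  have g[measurable]: "?g \<in> borel_measurable borel" using gC mN by auto
  have ig: "integrable ?N ?g"
    unfolding conditional_value_def by (rule C.real_cond_exp_int(1)[OF intN])
  have XG: "X \<in> ?G \<rightarrow>\<^sub>M coord_algebra S"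
    unfolding coord_algebra_def
    by (rule measurable_vimage_algebra2)
      (auto intro!: measurable_vimage_algebra1 simp: subvector_def space_PiM)
  have "AE \<omega> in M. real_cond_exp M ?G (\<lambda>\<omega>. F (X \<omega>)) \<omega> = ?g (X \<omega>)"
  proof (rule G.real_cond_exp_charact)
    show "integrable M (\<lambda>\<omega>. F (X \<omega>))" by fact
    show "integrable M (\<lambda>\<omega>. ?g (X \<omega>))" using ig by (simp add: integrable_distr_eq)
    show "(\<lambda>\<omega>. ?g (X \<omega>)) \<in> borel_measurable ?G"
      using measurable_compose[OF XG gC] by simp
    fix A assume "A \<in> sets ?G"
    then obtain B where B: "B \<in> sets ?P" "A = (\<lambda>\<omega>. subvector S (X \<omega>)) -` B \<inter> space M"
      using measurable_space[OF m] by (auto simp: sets_vimage_algebra2)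
    let ?C = "subvector S -` B"
    have C: "?C \<in> sets (coord_algebra S)"
      unfolding coord_algebra_def using in_vimage_algebra[OF B(1), of "subvector S" UNIV] by simp
    have Cb[measurable]: "?C \<in> sets borel"
      using measurable_sets[OF measurable_subvector B(1)] by simp
    have tr: "(LINT \<omega>:A|M. h (X \<omega>)) = (LINT x:?C|?N. h x)"
      if [measurable]: "h \<in> borel_measurable borel" for h :: "real ^ 'n \<Rightarrow> real"
    proof -
      have "(LINT x:?C|?N. h x) = (LINT \<omega>|M. indicator ?C (X \<omega>) *\<^sub>R h (X \<omega>))"
        unfolding set_lebesgue_integral_def by (subst integral_distr) auto
      also have "\<dots> = (LINT \<omega>:A|M. h (X \<omega>))"
        unfolding set_lebesgue_integral_def
        by (rule Bochner_Integration.integral_cong) (auto simp: B(2) indicator_def)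
      finally show ?thesis by simp
    qed
    show "(LINT \<omega>:A|M. F (X \<omega>)) = (LINT \<omega>:A|M. ?g (X \<omega>))"
      using C.real_cond_exp_intA[OF intN C] tr[OF F] tr[OF g]
      by (simp add: conditional_value_def)
  qed
  then show ?thesis by (auto elim: eventually_mono)
qed

end

theory Submission
  imports Defs
begin

text \<open>
  An effect on \<open>S\<close> only depends on the values on subsets of \<open>S\<close>, so it suffices to compare value
  functions. For linear and multilinear \<open>F\<close> the marginal expectation can be moved inside \<open>F\<close>. For independent
  features, gluing \<open>X\<^sub>S\<close> to the \<open>-S\<close> part of an independent copy of \<open>X\<close> reproduces the law of \<open>X\<close>,
  and Fubini's theorem identifies the marginal value as a version of the conditional expectation.
\<close>

text \<open>Strong induction on the size of \<open>S\<close>. Everything happens at one fixed point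
  \<open>x\<close>, so the lemma also applies inside an almost-everywhere statement.\<close>

lemma fanova_cong:
  assumes "\<And>T. T \<subseteq> S \<Longrightarrow> V T x = W T x"
  shows "fanova V S x = fanova W S x"
  using assms
proof (induction "card S" arbitrary: S rule: less_induct)
  case less
  have "fanova V T x = fanova W T x" if "T \<subset> S" for T
    using that less.prems by (intro less.hyps psubset_card_mono) auto
  then show ?case
    using less.prems by (simp add: fanova.simps[of V S x] fanova.simps[of W S x])
qed

lemma measurable_vec_nth [measurable (raw)]:
  fixes f :: "'a \<Rightarrow> real ^ 'n"
  assumes "f \<in> borel_measurable M"
  shows "(\<lambda>x. f x $ i) \<in> borel_measurable M"
  using measurable_compose[OF assms, of "\<lambda>x. x $ i" borel]
    borel_measurable_continuous_onI[of "\<lambda>x :: real ^ 'n. x $ i"]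
  by (simp add: continuous_on_component)

text \<open>Each component has to be measurable only on the side where it is used. This matters when
  the source sigma-algebra sees only the coordinates in \<open>S\<close>, as
  \<open>coord_algebra S\<close> does.\<close>

lemma measurable_vec_if:
  fixes f g :: "'a \<Rightarrow> 'n::finite \<Rightarrow> real"
  assumes "\<And>i. i \<in> S \<Longrightarrow> (\<lambda>x. f x i) \<in> borel_measurable M"
    and "\<And>i. i \<notin> S \<Longrightarrow> (\<lambda>x. g x i) \<in> borel_measurable M"
  shows "(\<lambda>x. \<chi> i. if i \<in> S then f x i else g x i) \<in> borel_measurable M"
proof (subst borel_measurable_euclidean_space, rule ballI)
  fix b :: "real ^ 'n" assume "b \<in> Basis"
  then obtain i where "b = axis i 1" by (auto simp: Basis_vec_def)
  then show "(\<lambda>x. (\<chi> i. if i \<in> S then f x i else g x i) \<bullet> b) \<in> borel_measurable M"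
    using assms by (cases "i \<in> S") (simp_all add: inner_axis)
qed

lemma measurable_glue [measurable (raw)]:
  assumes [measurable]: "f \<in> borel_measurable M" "g \<in> borel_measurable M"
  shows "(\<lambda>x. glue S (f x) (g x)) \<in> borel_measurable M"
  unfolding glue_def by (rule measurable_vec_if) measurable

lemma subvector_glue: "subvector S (glue S x y) = subvector S x"
  by (simp add: subvector_def glue_def fun_eq_iff restrict_def)

lemma glue_empty [simp]: "glue {} x y = y"
  by (simp add: glue_def vec_eq_iff)

context prob_space
begin

lemma
  fixes X :: "'a \<Rightarrow> real ^ 'n"
  assumes "integrable M X"
  shows integrable_vec_nth: "integrable M (\<lambda>\<omega>. X \<omega> $ i)"
    and expectation_vec_nth: "expectation (\<lambda>\<omega>. X \<omega> $ i) = expectation X $ i"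
  using assms bounded_linear_vec_nth integrable_bounded_linear integral_bounded_linear by blast+

text \<open>By independence the joint law of the blocks of \<open>X\<close> on \<open>S\<close> and
  \<open>- S\<close> is the product of their laws. Taking one block from each of two independent
  copies gives the same product law, and reassembling the blocks turns this equality into the
  claim.\<close>

lemma distr_glue_indep:
  fixes X :: "'a \<Rightarrow> real ^ 'n"
  assumes X [measurable]: "X \<in> borel_measurable M"
    and ind: "indep_vars (\<lambda>_. borel) (\<lambda>i \<omega>. X \<omega> $ i) UNIV"
  shows "distr (distr M borel X \<Otimes>\<^sub>M distr M borel X) borel (\<lambda>(x, y). glue S x y) = distr M borel X"
proof -
  interpret N: prob_space "distr M borel X" by (rule prob_space_distr) simp
  let ?N = "distr M borel X"
  let ?P = "\<lambda>A. Pi\<^sub>M A (\<lambda>_. borel :: real measure)"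
  \<comment> \<open>\<open>h\<close> rebuilds a point from its two blocks, so that
    \<open>glue S\<close> factors through the blocks, where independence is available.\<close>
  define h :: "('n \<Rightarrow> real) \<times> ('n \<Rightarrow> real) \<Rightarrow> real ^ 'n" where
    "h p = (\<chi> i. if i \<in> S then fst p i else snd p i)" for p
  have glue: "glue S x y = h (subvector S x, subvector (- S) y)" for x y
    by (simp add: glue_def h_def subvector_def vec_eq_iff)
  have h [measurable]: "h \<in> ?P S \<Otimes>\<^sub>M ?P (- S) \<rightarrow>\<^sub>M borel"
    unfolding h_def by (rule measurable_vec_if) auto
  have "indep_var (?P S) (\<lambda>\<omega>. subvector S (X \<omega>)) (?P (- S)) (\<lambda>\<omega>. subvector (- S) (X \<omega>))"
    using indep_var_restrict[OF ind, of S "- S"] by (simp add: subvector_def)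
  then have "distr M (?P S \<Otimes>\<^sub>M ?P (- S)) (\<lambda>\<omega>. (subvector S (X \<omega>), subvector (- S) (X \<omega>)))
      = distr M (?P S) (\<lambda>\<omega>. subvector S (X \<omega>)) \<Otimes>\<^sub>M distr M (?P (- S)) (\<lambda>\<omega>. subvector (- S) (X \<omega>))"
    by (simp add: indep_var_distribution_eq)
  \<comment> \<open>Each block law is an image of the law of \<open>X\<close>, and a product of
    images is the image of the product measure.\<close>
  also have "\<dots> = distr ?N (?P S) (subvector S) \<Otimes>\<^sub>M distr ?N (?P (- S)) (subvector (- S))"
    by (simp add: distr_distr comp_def)
  also have "\<dots> = distr (?N \<Otimes>\<^sub>M ?N) (?P S \<Otimes>\<^sub>M ?P (- S)) (\<lambda>(x, y). (subvector S x, subvector (- S) y))"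
    by (intro pair_measure_distr prob_space_imp_sigma_finite N.prob_space_distr) auto
  finally have eq: "distr M (?P S \<Otimes>\<^sub>M ?P (- S)) (\<lambda>\<omega>. (subvector S (X \<omega>), subvector (- S) (X \<omega>)))
      = distr (?N \<Otimes>\<^sub>M ?N) (?P S \<Otimes>\<^sub>M ?P (- S)) (\<lambda>(x, y). (subvector S x, subvector (- S) y))" .
  have "(\<lambda>(x, y). glue S x y) = h \<circ> (\<lambda>(x, y). (subvector S x, subvector (- S) y))"
    by (auto simp: glue)
  then have "distr (?N \<Otimes>\<^sub>M ?N) borel (\<lambda>(x, y). glue S x y) = distr (distr (?N \<Otimes>\<^sub>M ?N)
      (?P S \<Otimes>\<^sub>M ?P (- S)) (\<lambda>(x, y). (subvector S x, subvector (- S) y))) borel h"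
    by (subst distr_distr) auto
  also have "\<dots> = distr M borel (h \<circ> (\<lambda>\<omega>. (subvector S (X \<omega>), subvector (- S) (X \<omega>))))"
    unfolding eq[symmetric] by (subst distr_distr) auto
  also have "h \<circ> (\<lambda>\<omega>. (subvector S (X \<omega>), subvector (- S) (X \<omega>))) = X"
    by (simp add: h_def subvector_def vec_eq_iff fun_eq_iff)
  finally show ?thesis .
qed

text \<open>The defining properties of a conditional expectation are checked for the marginal value:
  integrability, measurability for the coordinate algebra, and equal integrals over each of its
  sets.\<close>

lemma conditional_value_eq_marginal_value:
  fixes X :: "'a \<Rightarrow> real ^ 'n" and F :: "real ^ 'n \<Rightarrow> real"
  assumes X [measurable]: "X \<in> borel_measurable M"
    and F [measurable]: "F \<in> borel_measurable borel"
    and int: "integrable M (\<lambda>\<omega>. F (X \<omega>))"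
    and ind: "indep_vars (\<lambda>_. borel) (\<lambda>i \<omega>. X \<omega> $ i) UNIV"
  shows "AE x in distr M borel X. conditional_value M X F S x = marginal_value M X F S x"
proof -
  let ?N = "distr M borel X"
  let ?C = "coord_algebra S :: (real ^ 'n) measure"
  interpret N: prob_space ?N by (rule prob_space_distr) simp
  interpret NN: pair_sigma_finite ?N ?N ..
  interpret C: sigma_finite_subalgebra ?N ?C
    by (rule finite_measure_subalgebra_is_sigma_finite)
      (simp add: finite_measure_subalgebra_def finite_measure_subalgebra_axioms_def
        subalgebra_coord_algebra N.finite_measure_axioms)
  let ?g = "marginal_value M X F S"
  have g: "?g x = (LINT y|?N. F (glue S x y))" for x
    by (simp add: marginal_value_def integral_distr)
  note law = distr_glue_indep[OF X ind, of S]
  \<comment> \<open>A change of variables along the gluing turns an integral over the law of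
    \<open>X\<close> into one over two independent copies, which Fubini then iterates.\<close>
  have fubini: "integrable (?N \<Otimes>\<^sub>M ?N) (\<lambda>(x, y). f (glue S x y))"
    "(LINT x|?N. LINT y|?N. f (glue S x y)) = (LINT x|?N. f x)"
    if [measurable]: "f \<in> borel_measurable borel" and f: "integrable ?N f"
    for f :: "real ^ 'n \<Rightarrow> real"
  proof -
    show i: "integrable (?N \<Otimes>\<^sub>M ?N) (\<lambda>(x, y). f (glue S x y))"
      using f by (subst (asm) law[symmetric]) (simp add: integrable_distr_eq case_prod_beta')
    have "(LINT x|?N. f x) = (LINT p|(?N \<Otimes>\<^sub>M ?N). f (glue S (fst p) (snd p)))"
      by (subst law[symmetric]) (simp add: integral_distr case_prod_beta')
    then show "(LINT x|?N. LINT y|?N. f (glue S x y)) = (LINT x|?N. f x)"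
      using NN.integral_fst'[OF i] by (simp add: case_prod_beta')
  qed
  have iF: "integrable ?N F" using int by (simp add: integrable_distr_eq)
  show ?thesis
    unfolding conditional_value_def
  proof (rule C.real_cond_exp_charact)
    show "integrable ?N F" by (fact iF)
    show "integrable ?N ?g"
      using NN.integrable_fst'[OF fubini(1)[OF F iF]] by (simp add: g[abs_def])
    have sv [measurable]: "subvector S \<in> ?C \<rightarrow>\<^sub>M Pi\<^sub>M S (\<lambda>_. borel)"
      unfolding coord_algebra_def
      by (rule measurable_vimage_algebra1) (auto simp: subvector_def space_PiM)
    \<comment> \<open>The first factor carries \<open>?C\<close> instead of the Borel sets, so that
      integrating out the second argument leaves a function measurable for \<open>?C\<close>.
      Coordinates in \<open>S\<close> are read through \<open>subvector S\<close>, the others from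
      the second factor.\<close>
    have [measurable]: "(\<lambda>p. glue S (fst p) (snd p)) \<in> ?C \<Otimes>\<^sub>M ?N \<rightarrow>\<^sub>M borel"
      unfolding glue_def
    proof (rule measurable_vec_if)
      fix i assume "i \<in> S"
      then have "(\<lambda>p. subvector S (fst p) i) \<in> borel_measurable (?C \<Otimes>\<^sub>M ?N)"
        by measurable
      then show "(\<lambda>p. fst p $ i) \<in> borel_measurable (?C \<Otimes>\<^sub>M ?N)"
        using \<open>i \<in> S\<close> by (simp add: subvector_def)
    qed measurable
    show "?g \<in> borel_measurable ?C"
      unfolding g[abs_def]
      by (rule N.borel_measurable_lebesgue_integral) (simp add: case_prod_beta')
    fix A assume A: "A \<in> sets ?C"
    then obtain B where B: "A = subvector S -` B"
      by (auto simp: coord_algebra_def sets_vimage_algebra2 subvector_def space_PiM)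
    have [measurable]: "A \<in> sets borel"
      using A subalgebra_coord_algebra[of M X S] by (auto simp: subalgebra_def)
    \<comment> \<open>Membership in \<open>A\<close> depends only on the coordinates in
      \<open>S\<close>, which gluing keeps; the indicator therefore leaves the inner integral when
      \<open>fubini\<close> is applied to \<open>F\<close> cut off to \<open>A\<close>.\<close>
    have ind: "indicator A (glue S x y) = (indicator A x :: real)" for x y
      by (simp add: B indicator_def subvector_glue)
    have "integrable ?N (\<lambda>x. indicator A x *\<^sub>R F x)"
      by (rule integrable_mult_indicator[OF _ iF]) simp
    from fubini(2)[OF _ this]
    show "(LINT x:A|?N. F x) = (LINT x:A|?N. ?g x)"
      by (simp add: set_lebesgue_integral_def g ind)
  qed
qed

lemma fanova_conditional_eq_marginal:
  fixes X :: "'a \<Rightarrow> real ^ 'n" and F :: "real ^ 'n \<Rightarrow> real"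
  assumes "X \<in> borel_measurable M" and "F \<in> borel_measurable borel"
    and "integrable M (\<lambda>\<omega>. F (X \<omega>))"
    and "indep_vars (\<lambda>_. borel) (\<lambda>i \<omega>. X \<omega> $ i) UNIV"
  shows "AE x in distr M borel X.
    fanova (conditional_value M X F) S x = fanova (marginal_value M X F) S x"
proof -
  \<comment> \<open>The exceptional null set depends on \<open>T\<close>; as there are finitely many
    \<open>T\<close>, one null set serves for all of them, and \<open>fanova_cong\<close> applies at
    each point outside it.\<close>
  have "AE x in distr M borel X. \<forall>T\<in>UNIV. conditional_value M X F T x = marginal_value M X F T x"
    using conditional_value_eq_marginal_value[OF assms] by (intro AE_finite_allI) auto
  then show ?thesis
    by eventually_elim (auto intro: fanova_cong)
qed

text \<open>Each coordinate of the glued point is a constant or a coordinate of \<open>X\<close>, so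
  its mean is that coordinate of the point glued with the mean; linearity of expectation does the
  rest.\<close>

lemma marginal_value_linear:
  fixes X :: "'a \<Rightarrow> real ^ 'n"
  assumes int: "integrable M X" and F: "\<And>x. F x = (\<Sum>i\<in>UNIV. \<beta> i * x $ i)"
  shows "marginal_value M X F S x = baseline_value (expectation X) F S x"
proof -
  have "integrable M (\<lambda>\<omega>. glue S x (X \<omega>) $ i)"
    and "expectation (\<lambda>\<omega>. glue S x (X \<omega>) $ i) = glue S x (expectation X) $ i" for i
    using integrable_vec_nth[OF int] expectation_vec_nth[OF int]
    by (cases "i \<in> S"; simp add: glue_def prob_space)+
  then show ?thesis
    by (simp add: marginal_value_def baseline_value_def F)
qed

text \<open>No coordinate is repeated in a monomial. Gluing splits it into a constant factor over
  \<open>L \<inter> S\<close> and a product of distinct independent coordinates over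
  \<open>L - S\<close>, whose expectation is the product of the means.\<close>

lemma
  fixes X :: "'a \<Rightarrow> real ^ 'n"
  assumes int: "integrable M X"
    and ind: "indep_vars (\<lambda>_. borel) (\<lambda>i \<omega>. X \<omega> $ i) UNIV"
    and F: "\<And>x. F x = (\<Sum>L\<in>Pow UNIV. c L * (\<Prod>i\<in>L. x $ i))"
  shows integrable_multilinear_glue: "integrable M (\<lambda>\<omega>. F (glue S x (X \<omega>)))"
    and marginal_value_multilinear:
      "marginal_value M X F S x = baseline_value (expectation X) F S x"
proof -
  have split: "(\<Prod>i\<in>L. glue S x y $ i) = (\<Prod>i\<in>L \<inter> S. x $ i) * (\<Prod>i\<in>L - S. y $ i)" for L y
    using prod.If_cases[of L "\<lambda>i. i \<in> S" "\<lambda>i. x $ i" "\<lambda>i. y $ i"]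
    by (simp add: glue_def Diff_eq)
  have indL: "indep_vars (\<lambda>_. borel) (\<lambda>i \<omega>. X \<omega> $ i) L" for L
    using indep_vars_subset[OF ind] by simp
  have p: "integrable M (\<lambda>\<omega>. \<Prod>i\<in>L. X \<omega> $ i)"
    "expectation (\<lambda>\<omega>. \<Prod>i\<in>L. X \<omega> $ i) = (\<Prod>i\<in>L. expectation X $ i)" for L
    using indep_vars_integrable[OF finite indL integrable_vec_nth[OF int]]
      indep_vars_lebesgue_integral[OF finite indL integrable_vec_nth[OF int]]
    by (simp_all add: expectation_vec_nth[OF int])
  show "integrable M (\<lambda>\<omega>. F (glue S x (X \<omega>)))"
    by (auto simp: F split intro!: p)
  show "marginal_value M X F S x = baseline_value (expectation X) F S x"
    by (simp add: marginal_value_def baseline_value_def F split p)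
qed

end

theorem theorem2:
  fixes M :: "'a measure" and X :: "'a \<Rightarrow> real ^ 'n" and F :: "real ^ 'n \<Rightarrow> real"
  assumes "prob_space M"
    and "X \<in> borel_measurable M"
    and "F \<in> borel_measurable borel"
  shows
    "(\<forall>\<beta> :: 'n \<Rightarrow> real.
        integrable M X \<longrightarrow>
        (\<forall>x. F x = (\<Sum>i\<in>UNIV. \<beta> i * x $ i)) \<longrightarrow>
        (\<forall>S x. fanova (marginal_value M X F) S x
             = fanova (baseline_value (prob_space.expectation M X) F) S x))
     \<and>
     (integrable M (\<lambda>\<omega>. F (X \<omega>)) \<longrightarrow>
        prob_space.indep_vars M (\<lambda>_. borel) (\<lambda>i \<omega>. X \<omega> $ i) UNIV \<longrightarrow>
        (\<forall>S. AE x in distr M borel X.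
           fanova (conditional_value M X F) S x = fanova (marginal_value M X F) S x))
     \<and>
     (\<forall>c :: 'n set \<Rightarrow> real.
        integrable M X \<longrightarrow>
        prob_space.indep_vars M (\<lambda>_. borel) (\<lambda>i \<omega>. X \<omega> $ i) UNIV \<longrightarrow>
        (\<forall>x. F x = (\<Sum>L\<in>Pow UNIV. c L * (\<Prod>i\<in>L. x $ i))) \<longrightarrow>
        (\<forall>S. (AE x in distr M borel X.
                fanova (conditional_value M X F) S x = fanova (marginal_value M X F) S x)
           \<and> (\<forall>x. fanova (marginal_value M X F) S x
                 = fanova (baseline_value (prob_space.expectation M X) F) S x)))"
proof (intro conjI allI impI)
  interpret prob_space M by fact
  show "fanova (marginal_value M X F) S x = fanova (baseline_value (expectation X) F) S x"
    if "integrable M X" "\<forall>x. F x = (\<Sum>i\<in>UNIV. \<beta> i * x $ i)" for \<beta> S x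
    using that by (intro fanova_cong marginal_value_linear) auto
  show "AE x in distr M borel X.
      fanova (conditional_value M X F) S x = fanova (marginal_value M X F) S x"
    if "integrable M (\<lambda>\<omega>. F (X \<omega>))" "indep_vars (\<lambda>_. borel) (\<lambda>i \<omega>. X \<omega> $ i) UNIV" for S
    using assms that by (intro fanova_conditional_eq_marginal)
  fix c assume int: "integrable M X" and ind: "indep_vars (\<lambda>_. borel) (\<lambda>i \<omega>. X \<omega> $ i) UNIV"
    and F: "\<forall>x. F x = (\<Sum>L\<in>Pow UNIV. c L * (\<Prod>i\<in>L. x $ i))"
  \<comment> \<open>In the multilinear case integrability of \<open>F\<close> along \<open>X\<close>
    is derived: gluing with the empty set returns \<open>X\<close> itself.\<close>
  have "integrable M (\<lambda>\<omega>. F (X \<omega>))"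
    using integrable_multilinear_glue[OF int ind F[rule_format], of "{}"] by simp
  then show "AE x in distr M borel X.
      fanova (conditional_value M X F) S x = fanova (marginal_value M X F) S x" for S
    using assms ind by (intro fanova_conditional_eq_marginal)
  show "fanova (marginal_value M X F) S x = fanova (baseline_value (expectation X) F) S x" for S x
    using marginal_value_multilinear[OF int ind F[rule_format]] by (intro fanova_cong)
qed

end
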